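(* Let $p$ be an odd prime and let $b$, $c$ and $m\not\equiv0\pmod p$ be rational $p$-adic integers. Then $$\sum_{k=0}^{p-1}\frac{\binom{2k}{k}^2}{(16m)^k}T_k(b,c)\equiv\left(\frac{-1}p\right)\sum_{k=0}^{p-1}\frac{\binom{2k}{k}^2}{(16m)^k}T_k(m-b,c)\pmod{p^2},$$ $$\sum_{k=0}^{p-1}\frac{\binom{2k}{k}\binom{4k}{2k}}{(64m)^k}T_k(b,c)\equiv\left(\frac{-2}p\right)\sum_{k=0}^{p-1}\frac{\binom{2k}{k}\binom{4k}{2k}}{(64m)^k}T_k(m-b,c)\pmod{p^2}.$$ If $p>3$, we also have $$\sum_{k=0}^{p-1}\frac{\binom{2k}{k}\binom{3k}{k}}{(27m)^k}T_k(b,c)\equiv\left(\frac p3\right)\sum_{k=0}^{p-1}\frac{\binom{2k}{k}\binom{3k}{k}}{(27m)^k}T_k(m-b,c)\pmod{p^2},$$ $$\sum_{k=0}^{p-1}\frac{\binom{3k}{k}\binom{6k}{3k}}{(432m)^k}T_k(b,c)\equiv\left(\frac{-1}p\right)\sum_{k=0}^{p-1}\frac{\binom{3k}{k}\binom{6k}{3k}}{(432m)^k}T_k(m-b,c)\pmod{p^2}.$$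
   Context: A rational $p$-adic integer is a rational number whose denominator is prime to $p$ (an element of $\mathbb{Z}_{(p)}$); the congruences are in $\mathbb{Z}_{(p)}$. For numbers $b,c$ and $n\ge0$, $T_n(b,c)=[t^n](t^2+bt+c)^n=\sum_{k=0}^{\lfloor n/2\rfloor}\binom{n}{2k}\binom{2k}{k}b^{n-2k}c^k$ (with $0^0=1$). $\left(\frac{\cdot}{\cdot}\right)$ is the Legendre symbol. *)

theory Defs
  imports "HOL-Number_Theory.Number_Theory" "HOL-Computational_Algebra.Polynomial"
begin

text \<open>The ring of rational \<open>p\<close>-adic integers, i.e. the localization of the integers at \<open>p\<close>.
  The second component of \<^const>\<open>quotient_of\<close> is the positive denominator in lowest terms.\<close>

definition padic_rats :: "nat \<Rightarrow> rat set" where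
  "padic_rats p = {x. coprime (snd (quotient_of x)) (int p)}"

text \<open>Congruence modulo \<open>n\<close> in that ring: the difference lies in the ideal generated by \<open>n\<close>.
  The library's congruence is not usable here, since over the field of rationals
  it is trivial for every nonzero modulus.\<close>

definition padic_cong :: "nat \<Rightarrow> rat \<Rightarrow> rat \<Rightarrow> nat \<Rightarrow> bool" where
  "padic_cong p x y n \<longleftrightarrow>
     x \<in> padic_rats p \<and> y \<in> padic_rats p \<and> (\<exists>z \<in> padic_rats p. x - y = of_nat n * z)"

text \<open>The coefficient of \<open>t ^ n\<close> in \<open>(t\<^sup>2 + b t + c) ^ n\<close>.\<close>

definition gen_trinomial :: "nat \<Rightarrow> rat \<Rightarrow> rat \<Rightarrow> rat" where
  "gen_trinomial n b c = coeff ([:c, b, 1:] ^ n) n"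

end

theory Submission
  imports Defs
begin

text \<open>Each weight, up to a power of a constant, is the product \<open>u k\<close> of the generalized binomial
  coefficients \<open>\<alpha>\<close> over \<open>k\<close> and \<open>- 1 - \<alpha>\<close> over \<open>k\<close> with \<open>\<alpha>\<close> one of \<open>-1/2\<close>, \<open>-1/4\<close>, \<open>-1/3\<close>,
  \<open>-1/6\<close>. Since \<open>T\<^sub>k(b, c)\<close> is the constant term of \<open>(t + b + c/t) ^ k\<close>, and \<open>t \<mapsto> - t\<close> turns
  \<open>1 - (t + b + c/t) / m\<close> into \<open>(t + (m - b) + c/t) / m\<close>, everything follows from the polynomial
  congruence \<open>F x \<equiv> \<plusminus> F (1 - x)\<close> modulo \<open>p\<^sup>2\<close> for \<open>F x = (\<Sum>k<p. u k * x ^ k)\<close>. For \<open>\<alpha> = n\<close> with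
  \<open>0 \<le> n < p\<close> this is the exact symmetry \<open>F x = (-1) ^ n * F (1 - x)\<close> of the Legendre polynomials.
  The coefficients of the difference are polynomials in \<open>\<alpha> (\<alpha> + 1)\<close>, and \<open>n \<equiv> \<alpha>\<close> and
  \<open>p - 1 - n \<equiv> - 1 - \<alpha>\<close> modulo \<open>p\<close> provide two roots, each contributing a factor \<open>p\<close>.\<close>

section \<open>The ring of rational \<open>p\<close>-adic integers\<close>

text \<open>The fraction need not be in lowest terms and \<open>b\<close> need not be positive: the
  reduced denominator divides \<open>b\<close> and so inherits its coprimality to
  \<open>p\<close>.\<close>

lemma padic_rats_divide_of_int:
  assumes "coprime b (int p)"
  shows "of_int a / of_int b \<in> padic_rats p"
proof (cases "b = 0")
  case True
  then show ?thesis by (simp add: padic_rats_def)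
next
  case False
  obtain n d where q: "quotient_of (of_int a / of_int b) = (n, d)"
    by fastforce
  have "d > 0" using quotient_of_denom_pos[OF q] .
  have "of_int a / of_int b = (of_int n / of_int d :: rat)"
    using quotient_of_div[OF q] .
  with False \<open>d > 0\<close> have "(of_int (a * d) :: rat) = of_int (n * b)"
    by (simp add: field_simps)
  then have "a * d = n * b" by (simp only: of_int_eq_iff)
  then have "d dvd n * b" by (metis dvd_triv_right)
  moreover have "coprime d n"
    using quotient_of_coprime[OF q] by (rule coprime_imp_coprime) auto
  ultimately have "d dvd b" by (simp only: coprime_dvd_mult_right_iff)
  then have "coprime d (int p)"
    by (rule coprime_divisors[OF _ dvd_refl assms])
  with q show ?thesis by (simp add: padic_rats_def)
qed

lemma padic_ratsE:
  assumes "x \<in> padic_rats p"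
  obtains a b where "x = of_int a / of_int b" "b > 0" "coprime b (int p)"
proof -
  obtain a b where q: "quotient_of x = (a, b)"
    by fastforce
  from assms q that[of a b] quotient_of_div[OF q] quotient_of_denom_pos[OF q]
  show thesis by (simp add: padic_rats_def)
qed

lemma padic_rats_of_int [simp]: "of_int a \<in> padic_rats p"
  using padic_rats_divide_of_int[of 1 p a] by simp

lemma padic_rats_of_nat [simp]: "of_nat a \<in> padic_rats p"
  using padic_rats_of_int[of "int a" p] by simp

lemma padic_rats_0 [simp]: "0 \<in> padic_rats p"
  and padic_rats_1 [simp]: "1 \<in> padic_rats p"
  using padic_rats_of_int[of 0 p] padic_rats_of_int[of 1 p] by simp_all

lemma padic_rats_inverse_of_nat:
  assumes "coprime n p"
  shows "inverse (of_nat n) \<in> padic_rats p"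
  using padic_rats_divide_of_int[of "int n" p 1] assms by (simp add: divide_simps)

lemma padic_rats_add [intro!]:
  assumes "x \<in> padic_rats p" "y \<in> padic_rats p"
  shows "x + y \<in> padic_rats p"
proof -
  obtain a b where x: "x = of_int a / of_int b" "b > 0" "coprime b (int p)"
    using assms(1) by (rule padic_ratsE)
  obtain c d where y: "y = of_int c / of_int d" "d > 0" "coprime d (int p)"
    using assms(2) by (rule padic_ratsE)
  have "x + y = of_int (a * d + c * b) / of_int (b * d)"
    unfolding x(1) y(1) using x(2) y(2) by (simp add: field_simps)
  moreover have "of_int (a * d + c * b) / of_int (b * d) \<in> padic_rats p"
    using x(3) y(3) by (intro padic_rats_divide_of_int) simp
  ultimately show ?thesis by (rule ssubst)
qed

lemma padic_rats_mult [intro!]: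
  assumes "x \<in> padic_rats p" "y \<in> padic_rats p"
  shows "x * y \<in> padic_rats p"
proof -
  obtain a b where x: "x = of_int a / of_int b" "b > 0" "coprime b (int p)"
    using assms(1) by (rule padic_ratsE)
  obtain c d where y: "y = of_int c / of_int d" "d > 0" "coprime d (int p)"
    using assms(2) by (rule padic_ratsE)
  have "x * y = of_int (a * c) / of_int (b * d)"
    unfolding x(1) y(1) using x(2) y(2) by (simp add: field_simps)
  moreover have "of_int (a * c) / of_int (b * d) \<in> padic_rats p"
    using x(3) y(3) by (intro padic_rats_divide_of_int) simp
  ultimately show ?thesis by (rule ssubst)
qed

lemma padic_rats_uminus [intro!]:
  assumes "x \<in> padic_rats p"
  shows "- x \<in> padic_rats p"
proof -
  have "of_int (- 1) * x \<in> padic_rats p"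
    using assms by (intro padic_rats_mult padic_rats_of_int)
  then show ?thesis by simp
qed

lemma padic_rats_diff [intro!]:
  "x \<in> padic_rats p \<Longrightarrow> y \<in> padic_rats p \<Longrightarrow> x - y \<in> padic_rats p"
  by (subst diff_conv_add_uminus) (rule padic_rats_add[OF _ padic_rats_uminus])

lemma padic_rats_sum [intro!]:
  "(\<And>i. i \<in> A \<Longrightarrow> f i \<in> padic_rats p) \<Longrightarrow> (\<Sum>i\<in>A. f i) \<in> padic_rats p"
  by (induction A rule: infinite_finite_induct) auto

lemma padic_rats_power [intro!]: "x \<in> padic_rats p \<Longrightarrow> x ^ n \<in> padic_rats p"
  by (induction n) auto

text \<open>Being nonzero modulo \<open>p\<close> makes the numerator prime to \<open>p\<close>, so
  the flipped fraction is again p-integral.\<close>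

lemma padic_rats_inverse:
  assumes "prime p" "x \<in> padic_rats p" "\<not> padic_cong p x 0 p"
  shows "inverse x \<in> padic_rats p"
proof -
  obtain a b where x: "x = of_int a / of_int b" "b > 0" "coprime b (int p)"
    using assms(2) by (rule padic_ratsE)
  have "\<not> int p dvd a"
  proof
    assume "int p dvd a"
    then obtain k where "a = int p * k" ..
    with x have "x - 0 = of_nat p * (of_int k / of_int b)" by simp
    moreover have "of_int k / of_int b \<in> padic_rats p"
      using x(3) by (rule padic_rats_divide_of_int)
    ultimately have "padic_cong p x 0 p"
      unfolding padic_cong_def using assms(2) padic_rats_0 by blast
    with assms(3) show False ..
  qed
  moreover have "prime (int p)" using assms(1) by simp
  ultimately have "coprime (int p) a"
    using prime_imp_coprime by blast
  then have "coprime a (int p)" by (simp only: coprime_commute)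
  with padic_rats_divide_of_int[of a p b] x show ?thesis by simp
qed

lemma padic_congI:
  assumes "y \<in> padic_rats p" "z \<in> padic_rats p" "x - y = of_nat n * z"
  shows "padic_cong p x y n"
proof -
  have "x = y + of_nat n * z" using assms(3) by simp
  with assms show ?thesis by (auto simp: padic_cong_def)
qed

section \<open>Polynomials with p-integral coefficients and their roots\<close>

definition padic_polys :: "nat \<Rightarrow> rat poly set" where
  "padic_polys p = {q. \<forall>i. coeff q i \<in> padic_rats p}"

lemma padic_polys_pCons [simp]:
  "pCons a q \<in> padic_polys p \<longleftrightarrow> a \<in> padic_rats p \<and> q \<in> padic_polys p"
  by (auto simp: padic_polys_def coeff_pCons split: nat.splits)

lemma padic_polys_0 [simp]: "0 \<in> padic_polys p"
  and padic_polys_1 [simp]: "1 \<in> padic_polys p"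
  by (simp_all add: padic_polys_def)

lemma padic_polys_diff [intro!]:
  "q \<in> padic_polys p \<Longrightarrow> r \<in> padic_polys p \<Longrightarrow> q - r \<in> padic_polys p"
  by (auto simp: padic_polys_def)

lemma padic_polys_smult [intro!]:
  "a \<in> padic_rats p \<Longrightarrow> q \<in> padic_polys p \<Longrightarrow> smult a q \<in> padic_polys p"
  by (auto simp: padic_polys_def)

lemma padic_polys_mult [intro!]:
  "q \<in> padic_polys p \<Longrightarrow> r \<in> padic_polys p \<Longrightarrow> q * r \<in> padic_polys p"
  by (auto simp: padic_polys_def coeff_mult)

lemma padic_polys_power [intro!]: "q \<in> padic_polys p \<Longrightarrow> q ^ n \<in> padic_polys p"
  by (induction n) auto

lemma padic_polys_sum [intro!]:
  "(\<And>i. i \<in> A \<Longrightarrow> f i \<in> padic_polys p) \<Longrightarrow> (\<Sum>i\<in>A. f i) \<in> padic_polys p"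
  by (auto simp: padic_polys_def coeff_sum)

lemma padic_polys_prod [intro!]:
  "(\<And>i. i \<in> A \<Longrightarrow> f i \<in> padic_polys p) \<Longrightarrow> (\<Prod>i\<in>A. f i) \<in> padic_polys p"
  by (induction A rule: infinite_finite_induct) auto

lemma poly_padic_rats [intro!]:
  "q \<in> padic_polys p \<Longrightarrow> x \<in> padic_rats p \<Longrightarrow> poly q x \<in> padic_rats p"
  by (induction q) auto

text \<open>Dividing by a monic linear polynomial is Horner's scheme, which divides no
  coefficient.\<close>

lemma synthetic_div_padic_polys [intro!]:
  "q \<in> padic_polys p \<Longrightarrow> x \<in> padic_rats p \<Longrightarrow> synthetic_div q x \<in> padic_polys p"
  by (induction q) auto

lemma poly_root_factor:
  fixes q :: "'a :: comm_ring_1 poly"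
  assumes "poly q a = 0"
  shows "poly q x = (x - a) * poly (synthetic_div q a) x"
  using arg_cong[OF synthetic_div_correct'[of a q], of "\<lambda>q. poly q x"] assms
  by (simp add: algebra_simps)

text \<open>Distinct roots \<open>a\<close>, \<open>b\<close> split off (x - a)(x - b) with a
  p-integral cofactor, and at \<open>s\<close> each linear factor contributes one \<open>p\<close>.
  If the roots coincide, only x - a can be split off, so \<open>dbl\<close> demands both powers of
  \<open>p\<close> from s - a.\<close>

lemma poly_square_dvd:
  assumes q: "q \<in> padic_polys p" and s: "s \<in> padic_rats p"
    and ab: "a \<in> padic_rats p" "b \<in> padic_rats p"
    and roots: "poly q a = 0" "poly q b = 0"
    and y: "s - a = of_nat p * y" "y \<in> padic_rats p"
    and z: "s - b = of_nat p * z" "z \<in> padic_rats p"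
    and dbl: "a = b \<Longrightarrow> \<exists>w\<in>padic_rats p. y = of_nat p * w"
  shows "\<exists>w\<in>padic_rats p. poly q s = of_nat (p\<^sup>2) * w"
proof -
  let ?h = "synthetic_div q a"
  have h: "?h \<in> padic_polys p" using q ab by auto
  show ?thesis
  proof (cases "a = b")
    case True
    then obtain w where w: "w \<in> padic_rats p" "y = of_nat p * w" using dbl by blast
    have "poly q s = of_nat (p\<^sup>2) * (w * poly ?h s)"
      by (simp add: poly_root_factor[OF roots(1), of s] y(1) w(2) power2_eq_square mult_ac)
    moreover have "w * poly ?h s \<in> padic_rats p"
      using w h s by auto
    ultimately show ?thesis ..
  next
    case False
    with poly_root_factor[OF roots(1), of b] roots(2) have hb: "poly ?h b = 0" by simp
    have "poly q s = of_nat (p\<^sup>2) * (y * (z * poly (synthetic_div ?h b) s))"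
      by (simp add: poly_root_factor[OF roots(1), of s] poly_root_factor[OF hb, of s]
          y(1) z(1) power2_eq_square mult_ac)
    moreover have "y * (z * poly (synthetic_div ?h b) s) \<in> padic_rats p"
      using q y(2) z(2) h s ab by (intro padic_rats_mult poly_padic_rats synthetic_div_padic_polys)
    ultimately show ?thesis ..
  qed
qed

section \<open>The reflection congruence\<close>

text \<open>An N-th finite difference. Pascal's rule on \<open>Suc N choose i\<close> reduces the
  sum to the cases \<open>M\<close> and \<open>Suc M\<close> of the induction hypothesis at
  \<open>Suc q\<close>; their difference collapses by Pascal's rule again.\<close>

lemma alternating_binomial_sum:
  "(\<Sum>i\<le>N. (-1) ^ i * of_nat (N choose i) * of_nat ((M + i) choose (N + q)))
     = ((-1) ^ N * of_nat (M choose q) :: 'a :: comm_ring_1)"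
proof (induction N arbitrary: M q)
  case 0
  show ?case by simp
next
  case (Suc N)
  let ?f = "\<lambda>x. of_nat (x choose (N + Suc q)) :: 'a"
  have "(\<Sum>i\<le>Suc N. (-1) ^ i * of_nat (Suc N choose i) * ?f (M + i))
      = ?f M + (\<Sum>i\<le>N. (-1) ^ Suc i * of_nat (N choose Suc i) * ?f (M + Suc i))
        - (\<Sum>i\<le>N. (-1) ^ i * of_nat (N choose i) * ?f (Suc M + i))"
    unfolding sum.atMost_Suc_shift[of _ N] binomial_Suc_Suc
    by (simp add: algebra_simps sum.distrib sum_negf sum_subtractf)
  also have "?f M + (\<Sum>i\<le>N. (-1) ^ Suc i * of_nat (N choose Suc i) * ?f (M + Suc i))
      = (\<Sum>i\<le>Suc N. (-1) ^ i * of_nat (N choose i) * ?f (M + i))"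
    by (subst sum.atMost_Suc_shift) simp
  also have "\<dots> = (\<Sum>i\<le>N. (-1) ^ i * of_nat (N choose i) * ?f (M + i))"
    by (simp add: binomial_eq_0)
  finally show ?case
    by (simp only: Suc.IH) (simp add: algebra_simps)
qed

text \<open>Up to the sign (-1)^j, this compares the coefficients of x^j in F(1 - x) = (-1)^n F(x),
  where F(x) is the Legendre polynomial P_n(1 - 2x). Since (n choose k)(k choose j) = (n choose
  j)(n-j choose k-j), it is the previous sum for N = n - j, M = n + j, q = j.\<close>

lemma legendre_reflection_coeff:
  "(\<Sum>k\<le>n. of_nat (k choose j) * ((-1) ^ k * of_nat (n choose k) * of_nat ((n + k) choose k)))
     = ((-1) ^ n * of_nat (n choose j) * of_nat ((n + j) choose j) :: 'a :: comm_ring_1)"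
proof (cases "j \<le> n")
  case False
  then show ?thesis by (simp add: binomial_eq_0)
next
  case True
  have *: "of_nat (k choose j) * ((-1) ^ k * of_nat (n choose k) * of_nat ((n + k) choose k))
      = (-1) ^ j * of_nat (n choose j) * ((-1) ^ i * of_nat ((n - j) choose i) *
          of_nat ((n + j + i) choose (n - j + j)) :: 'a)"
    if "k = i + j" "i \<le> n - j" for i k
  proof -
    have "k \<le> n" "j \<le> k" using that True by auto
    have a: "(n choose k) * (k choose j) = (n choose j) * ((n - j) choose i)"
      using choose_mult[OF \<open>j \<le> k\<close> \<open>k \<le> n\<close>] that by simp
    have b: "(n + k) choose k = (n + j + i) choose (n - j + j)"
      using binomial_symmetric[of k "n + k"] that True by (simp add: add_ac)
    have "of_nat (k choose j) * ((-1) ^ k * of_nat (n choose k) * of_nat ((n + k) choose k))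
        = (-1) ^ k * of_nat ((n choose k) * (k choose j)) * (of_nat ((n + k) choose k) :: 'a)"
      by (simp add: mult_ac)
    also have "\<dots> = (-1) ^ (i + j) * of_nat ((n choose j) * ((n - j) choose i))
        * of_nat ((n + j + i) choose (n - j + j))"
      by (simp only: a b) (simp only: that(1))
    finally show ?thesis by (simp add: power_add mult_ac)
  qed
  have "(\<Sum>k\<le>n. of_nat (k choose j) * ((-1) ^ k * of_nat (n choose k) * of_nat ((n + k) choose k)))
     = (\<Sum>k\<in>{j..n}. of_nat (k choose j) *
          ((-1) ^ k * of_nat (n choose k) * (of_nat ((n + k) choose k) :: 'a)))"
    by (rule sum.mono_neutral_right) (auto simp: binomial_eq_0)
  also have "\<dots> = (\<Sum>i\<le>n - j. (-1) ^ j * of_nat (n choose j) * ((-1) ^ i * of_nat ((n - j) choose i) *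
          of_nat ((n + j + i) choose (n - j + j))))"
  proof (rule sum.reindex_bij_witness[of _ "\<lambda>i. i + j" "\<lambda>k. k - j"], goal_cases)
    case (5 k)
    then show ?case using *[of k "k - j"] by auto
  qed (use True in auto)
  also have "\<dots> = (-1) ^ j * of_nat (n choose j) * ((-1) ^ (n - j) * of_nat ((n + j) choose j))"
    by (simp only: flip: sum_distrib_left) (simp only: alternating_binomial_sum)
  also have "\<dots> = (-1) ^ (j + (n - j)) * of_nat (n choose j) * of_nat ((n + j) choose j)"
    by (simp only: power_add mult_ac)
  finally show ?thesis using True by simp
qed

text \<open>With \<open>s = \<alpha> (\<alpha> + 1)\<close>, the value at \<open>s\<close> is the product of the generalized binomial
  coefficients \<open>\<alpha>\<close> over \<open>k\<close> and \<open>- 1 - \<alpha>\<close> over \<open>k\<close>.\<close>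

definition binom_pair_poly :: "nat \<Rightarrow> rat poly" where
  "binom_pair_poly k =
     (\<Prod>i<k. smult (inverse (of_nat (Suc i)) ^ 2) [:of_nat (i * Suc i), -1:])"

lemma binom_pair_poly_0 [simp]: "binom_pair_poly 0 = 1"
  by (simp add: binom_pair_poly_def)

lemma poly_binom_pair_poly_Suc:
  "poly (binom_pair_poly (Suc k)) s
     = (of_nat (k * Suc k) - s) / of_nat (Suc k) ^ 2 * poly (binom_pair_poly k) s"
  by (simp add: binom_pair_poly_def divide_inverse power_inverse algebra_simps)

text \<open>For \<alpha> = n the coefficient - 1 - n over k is (-1)^k times n + k over k.\<close>

lemma poly_binom_pair_poly_of_nat:
  "poly (binom_pair_poly k) (of_nat (n * Suc n))
     = (-1) ^ k * of_nat (n choose k) * of_nat ((n + k) choose k)"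
proof (induction k)
  case 0
  show ?case by simp
next
  case (Suc k)
  have "Suc k * (n choose Suc k) = (n choose k) * (n - k)"
    by (metis binomial_absorb_comp binomial_absorption mult.commute)
  then have "of_nat (Suc k * (n choose Suc k)) = (of_nat ((n choose k) * (n - k)) :: rat)"
    by (rule arg_cong)
  \<comment> \<open>For k > n the truncated difference does no harm, as \<open>n choose k\<close>
    vanishes.\<close>
  then have "of_nat (n choose Suc k) * of_nat (Suc k) = of_nat (n choose k) * (of_nat n - of_nat k :: rat)"
    by (cases "k \<le> n") (simp_all add: of_nat_diff binomial_eq_0 algebra_simps)
  then have a: "of_nat (n choose Suc k) = of_nat (n choose k) * (of_nat n - of_nat k) / (of_nat (Suc k) :: rat)"
    by (subst nonzero_eq_divide_eq[OF of_nat_neq_0])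
  have "Suc k * ((n + Suc k) choose Suc k) = Suc (n + k) * ((n + k) choose k)"
    using Suc_times_binomial_eq[of "n + k" k] by simp
  then have "of_nat (Suc k * ((n + Suc k) choose Suc k)) = (of_nat (Suc (n + k) * ((n + k) choose k)) :: rat)"
    by (rule arg_cong)
  then have b: "of_nat ((n + Suc k) choose Suc k)
      = of_nat (Suc (n + k)) * of_nat ((n + k) choose k) / (of_nat (Suc k) :: rat)"
    by (subst nonzero_eq_divide_eq[OF of_nat_neq_0]) (simp only: of_nat_mult mult.commute)
  show ?case
    unfolding poly_binom_pair_poly_Suc Suc.IH a b
    by (simp add: field_simps power2_eq_square del: binomial_Suc_Suc)
qed

lemma binom_pair_poly_padic:
  assumes "prime p" "k < p"
  shows "binom_pair_poly k \<in> padic_polys p"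
proof -
  have "inverse (of_nat (Suc i)) \<in> padic_rats p" if "i < k" for i
  proof (rule padic_rats_inverse_of_nat)
    have "\<not> p dvd Suc i" using that assms by (auto dest: dvd_imp_le)
    with assms(1) show "coprime (Suc i) p"
      by (metis coprime_commute prime_imp_coprime_nat)
  qed
  then show ?thesis
    unfolding binom_pair_poly_def
    by (intro padic_polys_prod padic_polys_smult padic_rats_power) (auto simp del: of_nat_Suc of_nat_mult)
qed

text \<open>At n (n + 1) the terms with k > n vanish, so cutting the sum off at \<open>p\<close>
  keeps the whole Legendre polynomial.\<close>

lemma binom_pair_poly_reflection:
  assumes "n < p"
  shows "(\<Sum>k<p. (-1) ^ j * of_nat (k choose j) * poly (binom_pair_poly k) (of_nat (n * Suc n)))
     = (-1) ^ n * poly (binom_pair_poly j) (of_nat (n * Suc n))"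
proof -
  have "(\<Sum>k<p. (-1) ^ j * of_nat (k choose j) * poly (binom_pair_poly k) (of_nat (n * Suc n)))
      = (\<Sum>k\<le>n. (-1) ^ j * of_nat (k choose j) * poly (binom_pair_poly k) (of_nat (n * Suc n)))"
    unfolding poly_binom_pair_poly_of_nat
    by (rule sum.mono_neutral_right) (use assms in auto)
  also have "\<dots> = (-1) ^ j * (\<Sum>k\<le>n. of_nat (k choose j) *
      ((-1) ^ k * of_nat (n choose k) * of_nat ((n + k) choose k)))"
    unfolding poly_binom_pair_poly_of_nat sum_distrib_left by (simp only: mult_ac)
  finally show ?thesis
    unfolding poly_binom_pair_poly_of_nat legendre_reflection_coeff by (simp only: mult_ac)
qed

text \<open>The left-hand side minus the right-hand side is a polynomial in \<open>s\<close> that vanishes at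
  \<open>n (n + 1)\<close> and, since \<open>p - 1 - n\<close> has the parity of \<open>n\<close>, also at \<open>(p - 1 - n) (p - n)\<close>. Both
  roots are congruent to \<open>s\<close>, which gives the second power of \<open>p\<close>.\<close>

lemma binom_pair_poly_reflection_cong:
  assumes "prime p" "odd p" "n < p" "j < p" and s: "s \<in> padic_rats p"
    and y: "s - of_nat (n * Suc n) = of_nat p * y" "y \<in> padic_rats p"
    and dbl: "2 * n + 1 = p \<Longrightarrow> \<exists>w\<in>padic_rats p. y = of_nat p * w"
  shows "\<exists>w\<in>padic_rats p.
    (\<Sum>k<p. (-1) ^ j * of_nat (k choose j) * poly (binom_pair_poly k) s)
      - (-1) ^ n * poly (binom_pair_poly j) s = of_nat (p\<^sup>2) * w"
proof -
  define n' where "n' = p - 1 - n"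
  \<comment> \<open>The coefficient of x^j in F(1 - x) - (-1)^n F(x), as a polynomial in \<alpha>
    (\<alpha> + 1).\<close>
  define G where "G = (\<Sum>k<p. smult ((-1) ^ j * of_nat (k choose j)) (binom_pair_poly k))
      - smult ((-1) ^ n) (binom_pair_poly j)"
  have p: "p = Suc (n + n')" using assms by (simp add: n'_def)
  have G: "poly G x = (\<Sum>k<p. (-1) ^ j * of_nat (k choose j) * poly (binom_pair_poly k) x)
      - (-1) ^ n * poly (binom_pair_poly j) x" for x
    by (simp add: G_def poly_sum)
  have "even (n + n')" using assms(2) p by simp
  then have sgn: "(-1) ^ n' = ((-1) ^ n :: rat)"
    by (simp add: minus_one_power_iff)
  have "\<exists>w\<in>padic_rats p. poly G s = of_nat (p\<^sup>2) * w"
  proof (rule poly_square_dvd[where a = "of_nat (n * Suc n)" and b = "of_nat (n' * Suc n')"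
        and y = y and z = "y + of_int (int n - int n')"])
    show "G \<in> padic_polys p"
      unfolding G_def using assms
      by (intro padic_polys_diff padic_polys_sum padic_polys_smult binom_pair_poly_padic)
        (auto intro!: padic_rats_mult padic_rats_power)
    show "poly G (of_nat (n * Suc n)) = 0"
      using binom_pair_poly_reflection[of n p j] assms by (simp only: G)
    show "poly G (of_nat (n' * Suc n')) = 0"
      using binom_pair_poly_reflection[of n' p j] p sgn by (simp only: G)
    \<comment> \<open>The difference is (n - n')(n + n' + 1), and n + n' + 1 = p.\<close>
    have "of_nat (n * Suc n) - of_nat (n' * Suc n')
        = of_nat p * (of_int (int n - int n') :: rat)"
      by (simp add: p algebra_simps)
    with y(1) show "s - of_nat (n' * Suc n') = of_nat p * (y + of_int (int n - int n'))"
      by (simp only: distrib_left)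
    show "\<exists>w\<in>padic_rats p. y = of_nat p * w"
      if "of_nat (n * Suc n) = (of_nat (n' * Suc n') :: rat)"
    proof (rule dbl)
      from that have "n * Suc n = n' * Suc n'" by (simp only: of_nat_eq_iff)
      then have "n = n'"
        using mult_strict_mono[of n n' "Suc n" "Suc n'"] mult_strict_mono[of n' n "Suc n'" "Suc n"]
        by (cases n n' rule: linorder_cases) auto
      with p show "2 * n + 1 = p" by simp
    qed
  qed (use y s in \<open>auto simp del: of_nat_mult of_nat_Suc of_int_diff\<close>)
  then show ?thesis by (simp only: G)
qed

section \<open>Generalized trinomial coefficients\<close>

lemma gen_trinomial_padic:
  assumes "b \<in> padic_rats p" "c \<in> padic_rats p"
  shows "gen_trinomial k b c \<in> padic_rats p"
proof -
  have "[:c, b, 1:] ^ k \<in> padic_polys p"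
    using assms by auto
  then show ?thesis by (simp add: gen_trinomial_def padic_polys_def)
qed

lemma gen_trinomial_uminus: "gen_trinomial k (- b) c = (-1) ^ k * gen_trinomial k b c"
proof -
  have "[:c, - b, 1:] = [:c, b, 1:] \<circ>\<^sub>p [:0, -1:]"
    by (simp add: pcompose_pCons)
  then have "[:c, - b, 1:] ^ k = ([:c, b, 1:] ^ k) \<circ>\<^sub>p [:0, -1:]"
    by (induction k) (simp_all only: power_0 power_Suc pcompose_mult pcompose_1)
  then show ?thesis by (simp add: gen_trinomial_def coeff_pcompose_linear)
qed

text \<open>Binomial theorem for (t^2 + b t + c) + m t: the factor (m t)^(k-j) moves the coefficient
  of t^k down to that of t^j, which is again central.\<close>

lemma gen_trinomial_add:
  "gen_trinomial k (b + m) c = (\<Sum>j\<le>k. of_nat (k choose j) * m ^ (k - j) * gen_trinomial j b c)"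
proof -
  have "[:c, b + m, 1:] = [:c, b, 1:] + monom m 1"
    by (simp add: monom_altdef)
  then have "coeff ([:c, b + m, 1:] ^ k) k
      = (\<Sum>j\<le>k. coeff (of_nat (k choose j) * [:c, b, 1:] ^ j * monom m 1 ^ (k - j)) k)"
    by (simp only: binomial_ring coeff_sum)
  also have "\<dots> = (\<Sum>j\<le>k. of_nat (k choose j) * m ^ (k - j) * coeff ([:c, b, 1:] ^ j) j)"
  proof (rule sum.cong)
    fix j assume "j \<in> {..k}"
    have "of_nat (k choose j) * [:c, b, 1:] ^ j * monom m 1 ^ (k - j)
        = smult (of_nat (k choose j)) (monom (m ^ (k - j)) (k - j) * [:c, b, 1:] ^ j)"
      by (simp add: monom_power of_nat_poly mult_ac)
    then show "coeff (of_nat (k choose j) * [:c, b, 1:] ^ j * monom m 1 ^ (k - j)) k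
        = of_nat (k choose j) * m ^ (k - j) * coeff ([:c, b, 1:] ^ j) j"
      using \<open>j \<in> {..k}\<close> by (simp add: coeff_monom_mult)
  qed simp
  finally show ?thesis by (simp add: gen_trinomial_def)
qed

text \<open>The expansion of (1 - x)^k under the linear map sending x^j to
  \<open>gen_trinomial j b c / m ^ j\<close>.\<close>

lemma gen_trinomial_reflect:
  assumes "m \<noteq> 0"
  shows "gen_trinomial k (m - b) c / m ^ k
    = (\<Sum>j\<le>k. of_nat (k choose j) * (-1) ^ j * (gen_trinomial j b c / m ^ j))"
proof -
  have "gen_trinomial k (m - b) c
      = (\<Sum>j\<le>k. of_nat (k choose j) * m ^ (k - j) * ((-1) ^ j * gen_trinomial j b c))"
    using gen_trinomial_add[of k "- b" m c] by (simp add: gen_trinomial_uminus)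
  then show ?thesis
    using assms by (auto simp: sum_divide_distrib power_diff intro!: sum.cong)
qed

text \<open>The inner sum on the right is the coefficient of x^j in F(1 - x), where F has the
  coefficients \<open>u k\<close>.\<close>

lemma trinomial_sum_reflect:
  assumes "m \<noteq> 0"
  shows "(\<Sum>k<p. u k * (gen_trinomial k (m - b) c / m ^ k))
    = (\<Sum>j<p. gen_trinomial j b c / m ^ j * (\<Sum>k<p. (-1) ^ j * of_nat (k choose j) * u k))"
proof -
  have "(\<Sum>k<p. u k * (gen_trinomial k (m - b) c / m ^ k))
      = (\<Sum>k<p. \<Sum>j<p. gen_trinomial j b c / m ^ j * ((-1) ^ j * of_nat (k choose j) * u k))"
  proof (rule sum.cong)
    fix k assume "k \<in> {..<p}"
    have "u k * (gen_trinomial k (m - b) c / m ^ k)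
        = (\<Sum>j\<le>k. gen_trinomial j b c / m ^ j * ((-1) ^ j * of_nat (k choose j) * u k))"
      using assms by (simp add: gen_trinomial_reflect sum_distrib_left mult_ac)
    also have "\<dots> = (\<Sum>j<p. gen_trinomial j b c / m ^ j * ((-1) ^ j * of_nat (k choose j) * u k))"
      by (rule sum.mono_neutral_left) (use \<open>k \<in> {..<p}\<close> in auto)
    finally show "u k * (gen_trinomial k (m - b) c / m ^ k)
        = (\<Sum>j<p. gen_trinomial j b c / m ^ j * ((-1) ^ j * of_nat (k choose j) * u k))" .
  qed simp
  also have "\<dots> = (\<Sum>j<p. gen_trinomial j b c / m ^ j * (\<Sum>k<p. (-1) ^ j * of_nat (k choose j) * u k))"
    by (subst sum.swap) (simp only: sum_distrib_left)
  finally show ?thesis .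
qed

text \<open>With \<open>r = p mod d\<close> one has \<open>- r / d \<equiv> p div d\<close> modulo \<open>p\<close>, so the argument of the weights is
  \<open>\<alpha> (\<alpha> + 1)\<close> for \<open>\<alpha> = - r / d\<close>.\<close>

lemma trinomial_sum_cong:
  fixes d :: nat
  assumes p: "prime p" "odd p"
    and bcm: "b \<in> padic_rats p" "c \<in> padic_rats p" "m \<in> padic_rats p" "\<not> padic_cong p m 0 p"
    and d: "coprime d p" "1 < d"
    and u: "\<And>k. u k = poly (binom_pair_poly k)
              (- (of_nat (p mod d) * (of_nat d - of_nat (p mod d))) / of_nat d ^ 2)"
    and \<sigma>: "\<sigma> = (-1) ^ (p div d)"
  shows "padic_cong p (\<Sum>k<p. u k * (gen_trinomial k b c / m ^ k))
           (\<sigma> * (\<Sum>k<p. u k * (gen_trinomial k (m - b) c / m ^ k))) (p\<^sup>2)"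
proof -
  define n where "n = p div d"
  define r where "r = p mod d"
  define s :: rat where "s = - (of_nat r * (of_nat d - of_nat r)) / of_nat d ^ 2"
  \<comment> \<open>As n = (p - r)/d, expanding gives n (n + 1) = s + p (p + d - 2r)/d^2.\<close>
  define y :: rat where "y = - of_int (int p + int d - 2 * int r) * inverse (of_nat d) ^ 2"
  have pdr: "p = d * n + r" by (simp add: n_def r_def)
  have "r < d" using d by (simp add: r_def)
  have us: "u k = poly (binom_pair_poly k) s" for k
    by (simp add: u s_def r_def)
  have invd: "inverse (of_nat d) \<in> padic_rats p"
    using d by (intro padic_rats_inverse_of_nat)
  have "n < p" using d p by (simp add: n_def prime_gt_0_nat)
  have s: "s \<in> padic_rats p"
  proof -
    have "s = - (of_nat r * (of_nat d - of_nat r)) * inverse (of_nat d) ^ 2"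
      by (simp add: s_def divide_inverse power_inverse)
    with invd show ?thesis by auto
  qed
  have y: "y \<in> padic_rats p" unfolding y_def using invd by (intro padic_rats_mult padic_rats_uminus padic_rats_power padic_rats_of_int)
  have sy: "s - of_nat (n * Suc n) = of_nat p * y"
    using d unfolding s_def y_def pdr by (simp add: field_simps power2_eq_square)
  \<comment> \<open>The double root occurs only for d = 2, where \<alpha> = -1/2 is fixed by
    \<alpha> \<mapsto> - 1 - \<alpha>; there d - 2r = 0, so y = -p/4 supplies the second
    \<open>p\<close>. For d \<ge> 3, 2n + 1 = dn + r leaves n \<le> 1, which forces p = 1 or p = d =
    3.\<close>
  have dbl: "\<exists>w\<in>padic_rats p. y = of_nat p * w" if "2 * n + 1 = p"
  proof (cases "d = 2")
    case True
    with pdr that have "r = 1" by simp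
    with True have "y = of_nat p * (- (inverse (of_nat d) ^ 2))" by (simp add: y_def)
    moreover have "- (inverse (of_nat d) ^ 2) \<in> padic_rats p"
      using invd by auto
    ultimately show ?thesis ..
  next
    case False
    then have "d \<ge> 3" using d by simp
    then have "3 * n \<le> d * n" by simp
    with pdr that have "n \<le> 1" by linarith
    then consider "n = 0" | "n = 1" by linarith
    then have False
    proof cases
      case 1
      with that p(1) show ?thesis by auto
    next
      case 2
      with that pdr \<open>d \<ge> 3\<close> have "d = 3" "p = 3" by auto
      with d show ?thesis by simp
    qed
    then show ?thesis ..
  qed
  have "m \<noteq> 0" using bcm by (auto simp: padic_cong_def intro!: bexI[of _ 0])
  have invm: "inverse m \<in> padic_rats p"
    using p bcm by (intro padic_rats_inverse)
  have t: "gen_trinomial k a c / m ^ k \<in> padic_rats p" if "a \<in> padic_rats p" for k a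
    using gen_trinomial_padic[OF that bcm(2), of k] invm
    by (auto simp: divide_inverse simp flip: power_inverse)
  have uR: "u k \<in> padic_rats p" if "k < p" for k
    unfolding us using that p s by (intro poly_padic_rats binom_pair_poly_padic)
  have "\<forall>j\<in>{..<p}. \<exists>w\<in>padic_rats p. (\<Sum>k<p. (-1) ^ j * of_nat (k choose j) * u k)
      - \<sigma> * u j = of_nat (p\<^sup>2) * w"
    unfolding us \<sigma> n_def[symmetric]
    using binom_pair_poly_reflection_cong[OF p \<open>n < p\<close> _ s sy y dbl] by blast
  then obtain w where "\<forall>j\<in>{..<p}. w j \<in> padic_rats p \<and> (\<Sum>k<p. (-1) ^ j * of_nat (k choose j) * u k)
      - \<sigma> * u j = of_nat (p\<^sup>2) * w j"
    unfolding Bex_def by (rule bchoice[THEN exE])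
  then have w: "\<And>j. j < p \<Longrightarrow> w j \<in> padic_rats p"
      "\<And>j. j < p \<Longrightarrow> (\<Sum>k<p. (-1) ^ j * of_nat (k choose j) * u k) = \<sigma> * u j + of_nat (p\<^sup>2) * w j"
    by (auto simp: diff_eq_eq add.commute)
  have e: "\<sigma> * \<sigma> = 1" "\<sigma> \<in> padic_rats p"
    unfolding \<sigma> by (simp flip: power_mult_distrib, auto)
  let ?W = "\<Sum>j<p. gen_trinomial j b c / m ^ j * w j"
  have "(\<Sum>k<p. u k * (gen_trinomial k (m - b) c / m ^ k))
      = (\<Sum>j<p. gen_trinomial j b c / m ^ j * (\<sigma> * u j + of_nat (p\<^sup>2) * w j))"
    unfolding trinomial_sum_reflect[OF \<open>m \<noteq> 0\<close>] using w by simp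
  also have "\<dots> = \<sigma> * (\<Sum>k<p. u k * (gen_trinomial k b c / m ^ k)) + of_nat (p\<^sup>2) * ?W"
    by (simp add: algebra_simps sum.distrib sum_distrib_left del: of_nat_power)
  \<comment> \<open>As \<sigma> is its own inverse, multiplying by it moves the sign to the
    reflected sum.\<close>
  finally have "\<sigma> * (\<Sum>k<p. u k * (gen_trinomial k (m - b) c / m ^ k))
      = (\<sigma> * \<sigma>) * (\<Sum>k<p. u k * (gen_trinomial k b c / m ^ k)) + of_nat (p\<^sup>2) * (\<sigma> * ?W)"
    by (simp only: distrib_left mult_ac)
  then have "(\<Sum>k<p. u k * (gen_trinomial k b c / m ^ k))
      - \<sigma> * (\<Sum>k<p. u k * (gen_trinomial k (m - b) c / m ^ k)) = of_nat (p\<^sup>2) * - (\<sigma> * ?W)"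
    using e by (simp del: of_nat_power)
  moreover have "- (\<sigma> * ?W) \<in> padic_rats p"
    using e w(1) t[OF bcm(1)] by (intro padic_rats_uminus padic_rats_mult padic_rats_sum) auto
  moreover have "\<sigma> * (\<Sum>k<p. u k * (gen_trinomial k (m - b) c / m ^ k)) \<in> padic_rats p"
    using e uR t[OF padic_rats_diff[OF bcm(3,1)]] by (intro padic_rats_mult padic_rats_sum) auto
  ultimately show ?thesis by (intro padic_congI)
qed

section \<open>The four weights\<close>

text \<open>Linear factors in k put the step from k to k + 1 of each weight, a quotient of
  factorials, in the form of the recurrence of \<open>binom_pair_poly\<close>.\<close>

lemma fact_2_Suc:
  "fact (2 * Suc k) = (2 * of_nat k + 2) * (2 * of_nat k + 1) * (fact (2 * k) :: rat)"
proof -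
  have "2 * Suc k = Suc (Suc (2 * k))" by simp
  then show ?thesis by (simp only: fact_Suc) (simp add: algebra_simps)
qed

lemma fact_3_Suc:
  "fact (3 * Suc k) = (3 * of_nat k + 3) * (3 * of_nat k + 2) * (3 * of_nat k + 1) * (fact (3 * k) :: rat)"
proof -
  have "3 * Suc k = Suc (Suc (Suc (3 * k)))" by simp
  then show ?thesis by (simp only: fact_Suc) (simp add: algebra_simps)
qed

lemma fact_4_Suc:
  "fact (4 * Suc k) = (4 * of_nat k + 4) * (4 * of_nat k + 3) * (4 * of_nat k + 2) * (4 * of_nat k + 1) * (fact (4 * k) :: rat)"
proof -
  have "4 * Suc k = Suc (Suc (Suc (Suc (4 * k))))" by simp
  then show ?thesis by (simp only: fact_Suc) (simp add: algebra_simps)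
qed

lemma fact_6_Suc:
  "fact (6 * Suc k) = (6 * of_nat k + 6) * (6 * of_nat k + 5) * (6 * of_nat k + 4) * (6 * of_nat k + 3) * (6 * of_nat k + 2) * (6 * of_nat k + 1) * (fact (6 * k) :: rat)"
proof -
  have "6 * Suc k = Suc (Suc (Suc (Suc (Suc (Suc (6 * k))))))" by simp
  then show ?thesis by (simp only: fact_Suc) (simp add: algebra_simps)
qed

text \<open>Here \<alpha> = -1/2. The weight is (2k)!^2 / k!^4, and both sides grow by the ratio
  (2k+1)^2 / (4 (k+1)^2).\<close>

lemma binom_pair_poly_half:
  "poly (binom_pair_poly k) (- (1 / 4)) = of_nat ((2 * k choose k)\<^sup>2) / 16 ^ k"
proof -
  let ?P = "\<lambda>k. poly (binom_pair_poly k) (- (1 / 4))"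
  have "fact k ^ 4 * 16 ^ k * ?P k = fact (2 * k) ^ 2"
  proof (induction k)
    case 0
    show ?case by simp
  next
    case (Suc k)
    define x :: rat where "x = of_nat k"
    \<comment> \<open>With factorials and powers replaced by free variables, the induction step is a
      polynomial identity: the claimed equation is an explicit combination of the recurrence and the
      induction hypothesis.\<close>
    have step: "((x + 1) * F) ^ 4 * (16 * S) * Q = ((2 * x + 2) * (2 * x + 1) * A) ^ 2"
      if "4 * (x + 1) ^ 2 * Q = (2 * x + 1) ^ 2 * P" "F ^ 4 * S * P = A ^ 2"
      for F A P Q S :: rat
    proof -
      have "((x + 1) * F) ^ 4 * (16 * S) * Q - ((2 * x + 2) * (2 * x + 1) * A) ^ 2
          = 4 * (x + 1) ^ 2 * F ^ 4 * S * (4 * (x + 1) ^ 2 * Q - (2 * x + 1) ^ 2 * P)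
            + 4 * (x + 1) ^ 2 * (2 * x + 1) ^ 2 * (F ^ 4 * S * P - A ^ 2)"
        by (simp add: algebra_simps power2_eq_square power3_eq_cube power4_eq_xxxx)
      with that show ?thesis by simp
    qed
    have "x + 1 \<noteq> 0" by (simp add: x_def add_eq_0_iff_both_eq_0)
    have rec: "4 * (x + 1) ^ 2 * ?P (Suc k) = (2 * x + 1) ^ 2 * ?P k"
      using \<open>x + 1 \<noteq> 0\<close>
      by (simp add: poly_binom_pair_poly_Suc add.commute[of 1] flip: x_def)
        (simp add: field_simps power2_eq_square)
    have "fact (Suc k) = (x + 1) * (fact k :: rat)"
      by (simp add: x_def algebra_simps)
    moreover have "fact (2 * Suc k) = (2 * x + 2) * (2 * x + 1) * (fact (2 * k) :: rat)"
      unfolding x_def by (rule fact_2_Suc)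
    moreover have "16 ^ Suc k = 16 * (16 ^ k :: rat)" by simp
    ultimately show ?case
      using step[OF rec Suc.IH] by (simp only:)
  qed
  then show ?thesis
    by (simp add: binomial_fact field_simps power2_eq_square numeral_eq_Suc)
qed

text \<open>Here \<alpha> = -1/4, and the weight is (4k)! / (k!^2 (2k)!).\<close>

lemma binom_pair_poly_quarter:
  "poly (binom_pair_poly k) (- (3 / 16)) = of_nat ((2 * k choose k) * (4 * k choose (2 * k))) / 64 ^ k"
proof -
  let ?P = "\<lambda>k. poly (binom_pair_poly k) (- (3 / 16))"
  have "fact k ^ 2 * fact (2 * k) * 64 ^ k * ?P k = fact (4 * k)"
  proof (induction k)
    case 0
    show ?case by simp
  next
    case (Suc k)
    define x :: rat where "x = of_nat k"
    have step: "((x + 1) * F) ^ 2 * ((2 * x + 2) * (2 * x + 1) * B) * (64 * S) * Q = (4 * x + 4) * (4 * x + 3) * (4 * x + 2) * (4 * x + 1) * A"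
      if "16 * (x + 1) ^ 2 * Q = ((4 * x + 1) * (4 * x + 3)) * P" "F ^ 2 * B * S * P = A"
      for F B A P Q S :: rat
    proof -
      have "((x + 1) * F) ^ 2 * ((2 * x + 2) * (2 * x + 1) * B) * (64 * S) * Q - (4 * x + 4) * (4 * x + 3) * (4 * x + 2) * (4 * x + 1) * A
          = 8 * (x + 1) * (2 * x + 1) * F ^ 2 * B * S * (16 * (x + 1) ^ 2 * Q - ((4 * x + 1) * (4 * x + 3)) * P)
            + 8 * (x + 1) * (2 * x + 1) * (4 * x + 1) * (4 * x + 3) * (F ^ 2 * B * S * P - A)"
        by (simp add: algebra_simps power2_eq_square power3_eq_cube power4_eq_xxxx)
      with that show ?thesis by simp
    qed
    have "x + 1 \<noteq> 0" by (simp add: x_def add_eq_0_iff_both_eq_0)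
    have rec: "16 * (x + 1) ^ 2 * ?P (Suc k) = ((4 * x + 1) * (4 * x + 3)) * ?P k"
      using \<open>x + 1 \<noteq> 0\<close>
      by (simp add: poly_binom_pair_poly_Suc add.commute[of 1] flip: x_def)
        (simp add: field_simps power2_eq_square)
    have "fact (Suc k) = (x + 1) * (fact k :: rat)"
      by (simp add: x_def algebra_simps)
    moreover have "fact (2 * Suc k) = (2 * x + 2) * (2 * x + 1) * (fact (2 * k) :: rat)"
      unfolding x_def by (rule fact_2_Suc)
    moreover have "fact (4 * Suc k) = (4 * x + 4) * (4 * x + 3) * (4 * x + 2) * (4 * x + 1) * (fact (4 * k) :: rat)"
      unfolding x_def by (rule fact_4_Suc)
    moreover have "64 ^ Suc k = 64 * (64 ^ k :: rat)" by simp
    ultimately show ?case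
      using step[OF rec Suc.IH] by (simp only:)
  qed
  then show ?thesis
    by (simp add: binomial_fact field_simps power2_eq_square numeral_eq_Suc)
qed

text \<open>Here \<alpha> = -1/3, and the weight is (3k)! / k!^3.\<close>

lemma binom_pair_poly_third:
  "poly (binom_pair_poly k) (- (2 / 9)) = of_nat ((2 * k choose k) * (3 * k choose k)) / 27 ^ k"
proof -
  let ?P = "\<lambda>k. poly (binom_pair_poly k) (- (2 / 9))"
  have "fact k ^ 3 * 27 ^ k * ?P k = fact (3 * k)"
  proof (induction k)
    case 0
    show ?case by simp
  next
    case (Suc k)
    define x :: rat where "x = of_nat k"
    have step: "((x + 1) * F) ^ 3 * (27 * S) * Q = (3 * x + 3) * (3 * x + 2) * (3 * x + 1) * A"
      if "9 * (x + 1) ^ 2 * Q = ((3 * x + 1) * (3 * x + 2)) * P" "F ^ 3 * S * P = A"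
      for F A P Q S :: rat
    proof -
      have "((x + 1) * F) ^ 3 * (27 * S) * Q - (3 * x + 3) * (3 * x + 2) * (3 * x + 1) * A
          = 3 * (x + 1) * F ^ 3 * S * (9 * (x + 1) ^ 2 * Q - ((3 * x + 1) * (3 * x + 2)) * P)
            + 3 * (x + 1) * (3 * x + 1) * (3 * x + 2) * (F ^ 3 * S * P - A)"
        by (simp add: algebra_simps power2_eq_square power3_eq_cube power4_eq_xxxx)
      with that show ?thesis by simp
    qed
    have "x + 1 \<noteq> 0" by (simp add: x_def add_eq_0_iff_both_eq_0)
    have rec: "9 * (x + 1) ^ 2 * ?P (Suc k) = ((3 * x + 1) * (3 * x + 2)) * ?P k"
      using \<open>x + 1 \<noteq> 0\<close>
      by (simp add: poly_binom_pair_poly_Suc add.commute[of 1] flip: x_def)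
        (simp add: field_simps power2_eq_square)
    have "fact (Suc k) = (x + 1) * (fact k :: rat)"
      by (simp add: x_def algebra_simps)
    moreover have "fact (3 * Suc k) = (3 * x + 3) * (3 * x + 2) * (3 * x + 1) * (fact (3 * k) :: rat)"
      unfolding x_def by (rule fact_3_Suc)
    moreover have "27 ^ Suc k = 27 * (27 ^ k :: rat)" by simp
    ultimately show ?case
      using step[OF rec Suc.IH] by (simp only:)
  qed
  then show ?thesis
    by (simp add: binomial_fact field_simps power2_eq_square numeral_eq_Suc)
qed

text \<open>Here \<alpha> = -1/6, and the weight is (6k)! / (k! (2k)! (3k)!).\<close>

lemma binom_pair_poly_sixth:
  "poly (binom_pair_poly k) (- (5 / 36)) = of_nat ((3 * k choose k) * (6 * k choose (3 * k))) / 432 ^ k"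
proof -
  let ?P = "\<lambda>k. poly (binom_pair_poly k) (- (5 / 36))"
  have "fact k * fact (2 * k) * fact (3 * k) * 432 ^ k * ?P k = fact (6 * k)"
  proof (induction k)
    case 0
    show ?case by simp
  next
    case (Suc k)
    define x :: rat where "x = of_nat k"
    have step: "(x + 1) * F * ((2 * x + 2) * (2 * x + 1) * B) * ((3 * x + 3) * (3 * x + 2) * (3 * x + 1) * C) * (432 * S) * Q = (6 * x + 6) * (6 * x + 5) * (6 * x + 4) * (6 * x + 3) * (6 * x + 2) * (6 * x + 1) * A"
      if "36 * (x + 1) ^ 2 * Q = ((6 * x + 1) * (6 * x + 5)) * P" "F * B * C * S * P = A"
      for F B C A P Q S :: rat
    proof -
      have "(x + 1) * F * ((2 * x + 2) * (2 * x + 1) * B) * ((3 * x + 3) * (3 * x + 2) * (3 * x + 1) * C) * (432 * S) * Q - (6 * x + 6) * (6 * x + 5) * (6 * x + 4) * (6 * x + 3) * (6 * x + 2) * (6 * x + 1) * A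
          = 72 * (x + 1) * (2 * x + 1) * (3 * x + 1) * (3 * x + 2) * F * B * C * S * (36 * (x + 1) ^ 2 * Q - ((6 * x + 1) * (6 * x + 5)) * P)
            + 72 * (x + 1) * (2 * x + 1) * (3 * x + 1) * (3 * x + 2) * (6 * x + 1) * (6 * x + 5) * (F * B * C * S * P - A)"
        by (simp add: algebra_simps power2_eq_square power3_eq_cube power4_eq_xxxx)
      with that show ?thesis by simp
    qed
    have "x + 1 \<noteq> 0" by (simp add: x_def add_eq_0_iff_both_eq_0)
    have rec: "36 * (x + 1) ^ 2 * ?P (Suc k) = ((6 * x + 1) * (6 * x + 5)) * ?P k"
      using \<open>x + 1 \<noteq> 0\<close>
      by (simp add: poly_binom_pair_poly_Suc add.commute[of 1] flip: x_def)
        (simp add: field_simps power2_eq_square)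
    have "fact (Suc k) = (x + 1) * (fact k :: rat)"
      by (simp add: x_def algebra_simps)
    moreover have "fact (2 * Suc k) = (2 * x + 2) * (2 * x + 1) * (fact (2 * k) :: rat)"
      unfolding x_def by (rule fact_2_Suc)
    moreover have "fact (3 * Suc k) = (3 * x + 3) * (3 * x + 2) * (3 * x + 1) * (fact (3 * k) :: rat)"
      unfolding x_def by (rule fact_3_Suc)
    moreover have "fact (6 * Suc k) = (6 * x + 6) * (6 * x + 5) * (6 * x + 4) * (6 * x + 3) * (6 * x + 2) * (6 * x + 1) * (fact (6 * k) :: rat)"
      unfolding x_def by (rule fact_6_Suc)
    moreover have "432 ^ Suc k = 432 * (432 ^ k :: rat)" by simp
    ultimately show ?case
      using step[OF rec Suc.IH] by (simp only:)
  qed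
  then show ?thesis
    by (simp add: binomial_fact field_simps power2_eq_square numeral_eq_Suc)
qed

section \<open>Legendre symbols\<close>

text \<open>Euler's criterion; for p > 2 the signs 1 and -1 differ modulo \<open>p\<close>, so the
  congruence determines the symbol.\<close>

lemma Legendre_eqI:
  assumes p: "prime p" "odd p" and "\<not> int p dvd a"
    and "[a ^ ((p - 1) div 2) = (-1) ^ e] (mod int p)"
  shows "Legendre a (int p) = (-1) ^ e"
proof -
  have "p > 2" using p by (metis prime_ge_2_nat le_neq_implies_less even_numeral)
  have "[Legendre a (int p) = (-1) ^ e] (mod int p)"
    using euler_criterion[OF p(1) \<open>p > 2\<close>] assms(4) by (rule cong_trans)
  then have "int p dvd Legendre a (int p) - (-1) ^ e"
    by (simp only: cong_iff_dvd_diff)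
  moreover have "Legendre a (int p) = 1 \<or> Legendre a (int p) = -1"
    using assms(3) by (simp add: Legendre_def cong_0_iff)
  moreover have "\<not> int p dvd 2" "\<not> int p dvd -2"
    using \<open>p > 2\<close> by (auto dest: zdvd_imp_le)
  ultimately show ?thesis
    by (cases "even e") auto
qed

lemma Legendre_minus_one:
  assumes "prime p" "odd p"
  shows "Legendre (-1) (int p) = (-1) ^ (p div 2)"
proof (rule Legendre_eqI[OF assms])
  show "\<not> int p dvd -1" using assms by (auto simp: prime_nat_iff)
  have "(p - 1) div 2 = p div 2" using assms(2) by (elim oddE) simp
  then show "[(-1) ^ ((p - 1) div 2) = (-1) ^ (p div 2)] (mod int p)" by simp
qed

text \<open>Gauss's lemma for \<open>2\<close>: the multiples \<open>2, 4, \<dots>, p - 1\<close> are already reduced, so it only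
  remains to count those exceeding \<open>(p - 1) / 2\<close>.\<close>

lemma two_power_half:
  assumes "prime p" "odd p"
  shows "[2 ^ (p div 2) = (-1) ^ (p div 2 - p div 4)] (mod int p)"
proof -
  define h where "h = p div 2"
  have p: "p = 2 * h + 1" using assms(2) by (simp add: h_def)
  have "p > 2" using assms by (metis prime_ge_2_nat le_neq_implies_less even_numeral)
  interpret GAUSS p 2
    using assms \<open>p > 2\<close> by unfold_locales (auto simp: cong_0_iff dest: zdvd_imp_le)
  have half: "(int p - 1) div 2 = int h" by (simp add: p)
  have "C = (\<lambda>x. 2 * x) ` {0<..int h}"
    unfolding C_def B_def A_def half image_image
    by (rule image_cong) (auto simp: p mult.commute)
  \<comment> \<open>2x exceeds h exactly when x exceeds \<open>h div 2\<close>.\<close>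
  then have "E = (\<lambda>x. 2 * x) ` {int (h div 2)<..int h}"
    unfolding E_def half by (auto simp: image_iff)
  then have "card E = h - h div 2"
    by (simp add: card_image inj_on_def nat_diff_distrib)
  moreover have "h div 2 = p div 4" by (simp add: h_def div_mult2_eq[symmetric])
  ultimately show ?thesis
    using pre_gauss_lemma by (simp add: half h_def)
qed

text \<open>The powers of -1 and of 2 combine to the exponent 2 (p div 2) - p div 4, which has the
  parity of \<open>p div 4\<close>.\<close>

lemma Legendre_minus_two:
  assumes "prime p" "odd p"
  shows "Legendre (-2) (int p) = (-1) ^ (p div 4)"
proof (rule Legendre_eqI[OF assms])
  have "p > 2" using assms by (metis prime_ge_2_nat le_neq_implies_less even_numeral)
  then show "\<not> int p dvd -2" by (auto dest: zdvd_imp_le)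
  have h: "(p - 1) div 2 = p div 2" using assms(2) by (elim oddE) simp
  have le: "p div 4 \<le> p div 2" by (intro div_le_mono2) auto
  have "[(-1) ^ (p div 2) * 2 ^ (p div 2) = (-1) ^ (p div 2) * (-1) ^ (p div 2 - p div 4)] (mod int p)"
    using two_power_half[OF assms] by (rule cong_scalar_left)
  moreover have "(-1) ^ (p div 2) * 2 ^ (p div 2) = (-2 :: int) ^ (p div 2)"
    by (simp flip: power_mult_distrib)
  moreover have "(-1) ^ (p div 2) * (-1) ^ (p div 2 - p div 4) = ((-1) ^ (p div 4) :: int)"
    using le by (simp add: minus_one_power_iff)
  ultimately show "[(-2) ^ ((p - 1) div 2) = (-1) ^ (p div 4)] (mod int p)"
    by (simp only: h)
qed

text \<open>As p = 3q + r is odd, q is even for r = 1 and odd for r = 2, while modulo 3 the residue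
  1 is a square and 2 is not.\<close>

lemma Legendre_three:
  assumes "prime p" "3 < p"
  shows "Legendre (int p) 3 = (-1) ^ (p div 3)"
proof -
  have "odd p" using assms prime_odd_nat[of p] by auto
  have "p mod 3 \<noteq> 0"
    using assms primes_dvd_imp_eq[of 3 p] by (auto simp: dvd_eq_mod_eq_0)
  then consider "p mod 3 = 1" | "p mod 3 = 2" by linarith
  then show ?thesis
  proof cases
    case 1
    then have p: "int p mod 3 = 1" by presburger
    then have "QuadRes 3 (int p)"
      by (auto simp: QuadRes_def cong_def intro!: exI[of _ 1])
    moreover have "even (p div 3)" using 1 \<open>odd p\<close> by presburger
    ultimately show ?thesis using p by (simp add: Legendre_def cong_def)
  next
    case 2
    then have p: "int p mod 3 = 2" by presburger
    have "y ^ 2 mod 3 \<noteq> 2" for y :: int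
    proof -
      have "y mod 3 = 0 \<or> y mod 3 = 1 \<or> y mod 3 = 2" by presburger
      moreover have "y ^ 2 mod 3 = (y mod 3) ^ 2 mod 3" by (simp only: power_mod)
      ultimately show ?thesis by auto
    qed
    with p have "\<not> QuadRes 3 (int p)" by (auto simp: QuadRes_def cong_def)
    moreover have "odd (p div 3)" using 2 \<open>odd p\<close> by presburger
    ultimately show ?thesis using p by (simp add: Legendre_def cong_def)
  qed
qed

theorem theorem5p1:
  fixes p :: nat and b c m :: rat
  assumes "prime p" and "odd p"
    and "b \<in> padic_rats p" and "c \<in> padic_rats p" and "m \<in> padic_rats p"
    and "\<not> padic_cong p m 0 p"
  shows
    "padic_cong p
       (\<Sum>k = 0..p - 1. of_nat (((2 * k) choose k)\<^sup>2) / (16 * m) ^ k * gen_trinomial k b c)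
       (of_int (Legendre (-1) (int p)) *
        (\<Sum>k = 0..p - 1. of_nat (((2 * k) choose k)\<^sup>2) / (16 * m) ^ k * gen_trinomial k (m - b) c))
       (p\<^sup>2) \<and>
     padic_cong p
       (\<Sum>k = 0..p - 1. of_nat (((2 * k) choose k) * ((4 * k) choose (2 * k))) / (64 * m) ^ k
          * gen_trinomial k b c)
       (of_int (Legendre (-2) (int p)) *
        (\<Sum>k = 0..p - 1. of_nat (((2 * k) choose k) * ((4 * k) choose (2 * k))) / (64 * m) ^ k
          * gen_trinomial k (m - b) c))
       (p\<^sup>2) \<and>
     (p > 3 \<longrightarrow>
       padic_cong p
         (\<Sum>k = 0..p - 1. of_nat (((2 * k) choose k) * ((3 * k) choose k)) / (27 * m) ^ k
            * gen_trinomial k b c)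
         (of_int (Legendre (int p) 3) *
          (\<Sum>k = 0..p - 1. of_nat (((2 * k) choose k) * ((3 * k) choose k)) / (27 * m) ^ k
            * gen_trinomial k (m - b) c))
         (p\<^sup>2) \<and>
       padic_cong p
         (\<Sum>k = 0..p - 1. of_nat (((3 * k) choose k) * ((6 * k) choose (3 * k))) / (432 * m) ^ k
            * gen_trinomial k b c)
         (of_int (Legendre (-1) (int p)) *
          (\<Sum>k = 0..p - 1. of_nat (((3 * k) choose k) * ((6 * k) choose (3 * k))) / (432 * m) ^ k
            * gen_trinomial k (m - b) c))
         (p\<^sup>2))"
proof -
  have p0: "p > 0" using assms(1) by (rule prime_gt_0_nat)
  then have range: "{0..p - 1} = {..<p}" by auto
  have scale: "x / (a * m) ^ k * t = x / a ^ k * (t / m ^ k)" for x a t :: rat and k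
    by (simp add: power_mult_distrib)
  note main = trinomial_sum_cong[OF assms]
  have two: "\<not> 2 dvd p" using assms(2) by simp
  have three: "\<not> 3 dvd p" if "3 < p"
    using that assms(1) primes_dvd_imp_eq[of 3 p] by auto
  show ?thesis
    unfolding range scale
  proof (intro conjI impI)
    have "p mod 2 = 1" using two by presburger
    then show "padic_cong p
       (\<Sum>k<p. of_nat (((2 * k) choose k)\<^sup>2) / 16 ^ k * (gen_trinomial k b c / m ^ k))
       (of_int (Legendre (-1) (int p)) *
        (\<Sum>k<p. of_nat (((2 * k) choose k)\<^sup>2) / 16 ^ k * (gen_trinomial k (m - b) c / m ^ k)))
       (p\<^sup>2)"
      using two assms(1,2)
      by (intro main[of 2]) (simp_all add: binom_pair_poly_half Legendre_minus_one)
  next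
    \<comment> \<open>The two residues are exchanged by r \<mapsto> d - r, that is by \<alpha>
      \<mapsto> - 1 - \<alpha>, so both lead to the same argument -3/16. The same happens below for
      3 and 6.\<close>
    have "p mod 4 = 1 \<or> p mod 4 = 3" using two by presburger
    moreover have "coprime 4 p"
      using two coprime_power_left_iff[of 2 2 p] by simp
    ultimately show "padic_cong p
       (\<Sum>k<p. of_nat (((2 * k) choose k) * ((4 * k) choose (2 * k))) / 64 ^ k
          * (gen_trinomial k b c / m ^ k))
       (of_int (Legendre (-2) (int p)) *
        (\<Sum>k<p. of_nat (((2 * k) choose k) * ((4 * k) choose (2 * k))) / 64 ^ k
          * (gen_trinomial k (m - b) c / m ^ k)))
       (p\<^sup>2)"
      using assms(1,2)
      by (intro main[of 4]) (auto simp: binom_pair_poly_quarter Legendre_minus_two)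
  next
    assume "3 < p"
    have "p mod 3 = 1 \<or> p mod 3 = 2" using three[OF \<open>3 < p\<close>] by presburger
    moreover have "coprime 3 p"
      using three[OF \<open>3 < p\<close>] by (intro prime_imp_coprime_nat) auto
    ultimately show "padic_cong p
         (\<Sum>k<p. of_nat (((2 * k) choose k) * ((3 * k) choose k)) / 27 ^ k
            * (gen_trinomial k b c / m ^ k))
         (of_int (Legendre (int p) 3) *
          (\<Sum>k<p. of_nat (((2 * k) choose k) * ((3 * k) choose k)) / 27 ^ k
            * (gen_trinomial k (m - b) c / m ^ k)))
         (p\<^sup>2)"
      using assms(1) \<open>3 < p\<close>
      by (intro main[of 3]) (auto simp: binom_pair_poly_third Legendre_three)
  next
    assume "3 < p"
    have "p mod 6 = 1 \<or> p mod 6 = 5" using two three[OF \<open>3 < p\<close>] by presburger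
    moreover have "coprime 3 p" "coprime 2 p"
      using two three[OF \<open>3 < p\<close>] by (auto intro!: prime_imp_coprime_nat)
    then have "coprime 6 p"
      using coprime_mult_left_iff[of 2 3 p] by simp
    \<comment> \<open>If p is 6q + 1 or 6q + 5, then \<open>p div 2\<close> is 3q or 3q + 2, of the
      parity of q; hence the symbol of -1 is the sign for d = 6.\<close>
    moreover have "even (p div 2) \<longleftrightarrow> even (p div 6)"
      using two three[OF \<open>3 < p\<close>] by presburger
    then have "(-1) ^ (p div 2) = ((-1) ^ (p div 6) :: rat)"
      by (simp add: minus_one_power_iff)
    ultimately show "padic_cong p
         (\<Sum>k<p. of_nat (((3 * k) choose k) * ((6 * k) choose (3 * k))) / 432 ^ k
            * (gen_trinomial k b c / m ^ k))
         (of_int (Legendre (-1) (int p)) *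
          (\<Sum>k<p. of_nat (((3 * k) choose k) * ((6 * k) choose (3 * k))) / 432 ^ k
            * (gen_trinomial k (m - b) c / m ^ k)))
         (p\<^sup>2)"
      using assms(1,2)
      by (intro main[of 6]) (auto simp: binom_pair_poly_sixth Legendre_minus_one)
  qed
qed

end
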